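(* For any function $f:2^{<\omega}\to\omega$, either $\mathcal{LK}(f)=2^{\omega}$ or $\mathcal{KT}(\Delta^0_2)\nsubseteq\mathcal{LK}(f)$.
   Context: Reals are elements of $2^{\omega}$ (infinite binary sequences); $A\upharpoonright n$ is the initial segment of $A$ of length $n$. $K(\sigma)$ is the prefix-free Kolmogorov complexity of the finite binary string $\sigma\in 2^{<\omega}$ with respect to a fixed universal prefix-free (oracle) machine, $K^A(\sigma)$ is its relativization to the oracle $A$, and for $n \in \omega$, $K(n)$ denotes the complexity of the string of $n$ zeros. For $f:2^{<\omega}\to\omega$, $\mathcal{LK}(f)$ is the set of reals $A$ for which there is a constant $c$ such that for all $\sigma\in 2^{<\omega}$, $K(\sigma)\leq K^A(\sigma)+f(\sigma)+c$. An order is a function $g:\omega\to\omega$ that is nondecreasing and unbounded (not necessarily recursive). For $g:\omega\to\omega$, $\mathcal{KT}(g)$ is the set of reals $A$ for which there is a constant $c$ such that for all $n\in\omega$, $K(A\upharpoonright n)\leq K(n)+g(n)+c$. $\mathcal{KT}(\Delta^0_2)$ is the intersection of $\mathcal{KT}(g)$ over all $\Delta^0_2$ orders $g$. *)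

theory Defs
  imports "HOL-Library.Sublist"
begin

section \<open>Computability relative to an oracle\<close>

text \<open>Reals are infinite binary sequences; as oracles they are read as sets of naturals.\<close>

type_synonym real_seq = "nat \<Rightarrow> bool"

text \<open>Programs for the functions that are partial recursive in an oracle: Kleene's
  \<open>\<mu>\<close>-recursive functions, with a query to the oracle as an additional initial function.\<close>

datatype prog =
    Zero
  | Succ
  | Proj nat
  | Query
  | Comp prog "prog list"
  | Prec prog prog
  | Mu prog

text \<open>\<open>evals A p xs y\<close>: with oracle \<open>A\<close>, program \<open>p\<close> halts on the arguments \<open>xs\<close> with
  value \<open>y\<close>.  Recursion and minimisation act on the first argument.\<close>

inductive evals :: "real_seq \<Rightarrow> prog \<Rightarrow> nat list \<Rightarrow> nat \<Rightarrow> bool" for A :: real_seq where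
  zero: "evals A Zero xs 0"
| succ: "evals A Succ [x] (Suc x)"
| proj: "i < length xs \<Longrightarrow> evals A (Proj i) xs (xs ! i)"
| query: "evals A Query [x] (of_bool (A x))"
| comp: "list_all2 (\<lambda>q y. evals A q xs y) qs ys \<Longrightarrow> evals A p ys z \<Longrightarrow> evals A (Comp p qs) xs z"
| prec_0: "evals A p xs y \<Longrightarrow> evals A (Prec p q) (0 # xs) y"
| prec_Suc: "evals A (Prec p q) (n # xs) r \<Longrightarrow> evals A q (n # r # xs) y
    \<Longrightarrow> evals A (Prec p q) (Suc n # xs) y"
| mu: "evals A p (n # xs) 0 \<Longrightarrow> (\<forall>m<n. \<exists>k. evals A p (m # xs) (Suc k))
    \<Longrightarrow> evals A (Mu p) xs n"

lemma evals_deterministic: "evals A p xs y \<Longrightarrow> evals A p xs z \<Longrightarrow> y = z"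
proof (induction arbitrary: z rule: evals.induct)
  case (zero xs)
  then show ?case by cases simp
next
  case (succ x)
  then show ?case by cases simp
next
  case (proj i xs)
  from proj.prems show ?case by cases simp
next
  case (query x)
  then show ?case by cases simp
next
  case (comp xs qs ys p w)
  from comp.prems obtain zs where zs: "list_all2 (\<lambda>q y. evals A q xs y) qs zs" "evals A p zs z"
    by cases
  have "ys = zs"
  proof (rule nth_equalityI)
    show len: "length ys = length zs"
      using list_all2_lengthD[OF comp.IH(1)] list_all2_lengthD[OF zs(1)] by simp
    show "ys ! i = zs ! i" if "i < length ys" for i
      using that list_all2_nthD2[OF comp.IH(1) that] list_all2_nthD2[OF zs(1), of i] len by simp
  qed
  with zs(2) comp.IH(2) show ?case by simp
next
  case (prec_0 p xs y q)
  from prec_0.prems show ?case by cases (rule prec_0.IH)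
next
  case (prec_Suc p q n xs r y)
  from prec_Suc.prems obtain s where "evals A (Prec p q) (n # xs) s" "evals A q (n # s # xs) z"
    by cases
  with prec_Suc.IH show ?case by simp
next
  case (mu p n xs)
  from mu.prems show ?case
  proof cases
    case mu': mu
    show ?thesis
    proof (rule linorder_cases[of n z])
      assume "n < z"
      with mu' obtain k where "evals A p (n # xs) (Suc k)" by auto
      from mu.IH(1)[OF this] show ?thesis by simp
    next
      assume "n = z"
      then show ?thesis .
    next
      assume "z < n"
      with mu.IH(2) obtain k where "\<forall>w. evals A p (z # xs) w \<longrightarrow> Suc k = w" by auto
      with mu' show ?thesis by auto
    qed
  qed
qed

text \<open>Computable means computable with the empty oracle.\<close>

definition computable_rel :: "nat \<Rightarrow> (nat list \<Rightarrow> bool) \<Rightarrow> bool" where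
  "computable_rel k R \<longleftrightarrow>
     (\<exists>p. \<forall>xs. length xs = k \<longrightarrow> evals (\<lambda>_. False) p xs (of_bool (R xs)))"

text \<open>The second level of the arithmetical hierarchy, for \<open>k\<close>-ary relations.\<close>

definition Sigma02 :: "nat \<Rightarrow> (nat list \<Rightarrow> bool) \<Rightarrow> bool" where
  "Sigma02 k R \<longleftrightarrow> (\<exists>S. computable_rel (k + 2) S \<and>
     (\<forall>xs. length xs = k \<longrightarrow> (R xs \<longleftrightarrow> (\<exists>a. \<forall>b. S (a # b # xs)))))"

definition Pi02 :: "nat \<Rightarrow> (nat list \<Rightarrow> bool) \<Rightarrow> bool" where
  "Pi02 k R \<longleftrightarrow> (\<exists>S. computable_rel (k + 2) S \<and>
     (\<forall>xs. length xs = k \<longrightarrow> (R xs \<longleftrightarrow> (\<forall>a. \<exists>b. S (a # b # xs)))))"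

definition Delta02 :: "nat \<Rightarrow> (nat list \<Rightarrow> bool) \<Rightarrow> bool" where
  "Delta02 k R \<longleftrightarrow> Sigma02 k R \<and> Pi02 k R"

text \<open>A function is \<open>\<Delta>\<^sup>0\<^sub>2\<close> if its graph is.\<close>

definition Delta02_fun :: "(nat \<Rightarrow> nat) \<Rightarrow> bool" where
  "Delta02_fun g \<longleftrightarrow> Delta02 2 (\<lambda>xs. g (xs ! 0) = xs ! 1)"


section \<open>Prefix-free machines and Kolmogorov complexity\<close>

text \<open>A computable bijection between binary strings and naturals (bijective base 2, least
  significant digit first), through which programs act on strings.\<close>

fun str_code :: "bool list \<Rightarrow> nat" where
  "str_code [] = 0"
| "str_code (b # bs) = 2 * str_code bs + (if b then 2 else 1)"

lemma bij_str_code: "bij str_code"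
proof (rule bijI)
  have "str_code x = str_code y \<Longrightarrow> x = y" for x y
  proof (induction x arbitrary: y)
    case Nil
    then show ?case by (cases y) (simp_all split: if_splits)
  next
    case (Cons a x)
    then obtain b z where y: "y = b # z" by (cases y) (simp_all split: if_splits)
    have "2 * str_code x + (if a then 2 else 1) = 2 * str_code z + (if b then 2 else 1)"
      using Cons.prems y by simp
    then have "a = b \<and> str_code x = str_code z"
      by (cases a; cases b) (simp_all, presburger+)
    with y Cons.IH show ?case by simp
  qed
  then show "inj str_code" by (rule injI)
next
  have "\<exists>s. str_code s = n" for n
  proof (induction n rule: less_induct)
    case (less n)
    show ?case
    proof (cases "n = 0")
      case True
      then have "str_code [] = n" by simp
      then show ?thesis ..
    next
      case False
      then have "(n - 1) div 2 < n" by presburger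
      from less.IH[OF this] obtain s where s: "str_code s = (n - 1) div 2" ..
      have "2 * ((n - 1) div 2) + (if even n then 2 else 1) = n"
        using False by presburger
      with s have "str_code (even n # s) = n" by simp
      then show ?thesis ..
    qed
  qed
  then show "surj str_code" unfolding surj_def by metis
qed

type_synonym oracle_machine = "real_seq \<Rightarrow> bool list \<Rightarrow> bool list option"

definition prefix_free :: "bool list set \<Rightarrow> bool" where
  "prefix_free D \<longleftrightarrow> (\<forall>\<sigma>\<in>D. \<forall>\<tau>\<in>D. prefix \<sigma> \<tau> \<longrightarrow> \<sigma> = \<tau>)"

text \<open>One program computes the machine for all oracles, and the domain is prefix-free for every
  oracle.\<close>

definition prefix_free_machine :: "oracle_machine \<Rightarrow> bool" where
  "prefix_free_machine M \<longleftrightarrow>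
     (\<exists>p. \<forall>A \<sigma> \<tau>. M A \<sigma> = Some \<tau> \<longleftrightarrow> evals A p [str_code \<sigma>] (str_code \<tau>)) \<and>
     (\<forall>A. prefix_free (dom (M A)))"

text \<open>The coding prefix \<open>\<rho>\<close> of \<open>M\<close> does not depend on the oracle.\<close>

definition universal_machine :: "oracle_machine \<Rightarrow> bool" where
  "universal_machine U \<longleftrightarrow> prefix_free_machine U \<and>
     (\<forall>M. prefix_free_machine M \<longrightarrow> (\<exists>\<rho>. \<forall>A \<sigma>. U A (\<rho> @ \<sigma>) = M A \<sigma>))"

text \<open>The complexity of a string relative to \<open>A\<close>.  For a universal machine every string has a
  description, so \<open>LEAST\<close> is a genuine minimum.\<close>

definition KO :: "oracle_machine \<Rightarrow> real_seq \<Rightarrow> bool list \<Rightarrow> nat" where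
  "KO U A \<sigma> = (LEAST n. \<exists>\<pi>. length \<pi> = n \<and> U A \<pi> = Some \<sigma>)"

definition K :: "oracle_machine \<Rightarrow> bool list \<Rightarrow> nat" where
  "K U \<sigma> = KO U (\<lambda>_. False) \<sigma>"

definition K_nat :: "oracle_machine \<Rightarrow> nat \<Rightarrow> nat" where
  "K_nat U n = K U (replicate n False)"


section \<open>Weak lowness and weak triviality classes\<close>

definition LK :: "oracle_machine \<Rightarrow> (bool list \<Rightarrow> nat) \<Rightarrow> real_seq set" where
  "LK U f = {A. \<exists>c. \<forall>\<sigma>. K U \<sigma> \<le> KO U A \<sigma> + f \<sigma> + c}"

definition initial_segment :: "real_seq \<Rightarrow> nat \<Rightarrow> bool list" where
  "initial_segment A n = map A [0..<n]"

definition KT :: "oracle_machine \<Rightarrow> (nat \<Rightarrow> nat) \<Rightarrow> real_seq set" where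
  "KT U g = {A. \<exists>c. \<forall>n. K U (initial_segment A n) \<le> K_nat U n + g n + c}"

definition order_fun :: "(nat \<Rightarrow> nat) \<Rightarrow> bool" where
  "order_fun g \<longleftrightarrow> mono g \<and> \<not> bdd_above (range g)"

definition KT_Delta02 :: "oracle_machine \<Rightarrow> real_seq set" where
  "KT_Delta02 U = (\<Inter>g\<in>{g. order_fun g \<and> Delta02_fun g}. KT U g)"

end

(*
  If LK(f) is not everything, then K(s_i) > f(s_i) + 2i for some strings s_i, so it suffices to
  find A in KT(Delta02) with K^A(s_i) <= i + O(1).  Take A = {p_0 < p_1 < ...} where p_i encodes
  (i, s_i, m_i), so that A finds s_i from i.  The padding m_i makes p_i cheap: it is a stage by
  which a computable approximation to some z with g(z) >= 2j, for the first few Delta02 orders g,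
  has settled.  Such a stage can be recovered from j and any n >= p_i, because the approximation
  run for n steps already shows when it last changed.  Hence, for p_i < n <= p_{i+1}, a description
  of n costs only j + O(1) more bits to become one of A restricted to n, where O(1) depends on
  p_0, ..., p_{i-1}; taking j large makes this at most g(p_i).
*)
theory Submission
  imports Defs "HOL-Library.Nat_Bijection" "HOL-Library.Countable_Set"
begin

section \<open>Functions computed by oracle programs\<close>

text \<open>One program serves all oracles in \<open>\<X>\<close>; \<open>{\<lambda>_. False}\<close> gives computability, and \<open>UNIV\<close> what
  a prefix-free oracle machine needs.\<close>

definition computable_on :: "real_seq set \<Rightarrow> nat \<Rightarrow> (real_seq \<Rightarrow> nat list \<Rightarrow> nat) \<Rightarrow> bool" where
  "computable_on \<X> k F \<longleftrightarrow> (\<exists>p. \<forall>X\<in>\<X>. \<forall>xs. length xs = k \<longrightarrow> evals X p xs (F X xs))"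

abbreviation decidable_on :: "real_seq set \<Rightarrow> nat \<Rightarrow> (real_seq \<Rightarrow> nat list \<Rightarrow> bool) \<Rightarrow> bool" where
  "decidable_on \<X> k P \<equiv> computable_on \<X> k (\<lambda>X xs. of_bool (P X xs))"

named_theorems computable_intros

section \<open>Composition, constants and projections\<close>

lemma computable_on_cong:
  assumes "computable_on \<X> k F"
    and "\<And>X xs. X \<in> \<X> \<Longrightarrow> length xs = k \<Longrightarrow> F X xs = G X xs"
  shows "computable_on \<X> k G"
  using assms unfolding computable_on_def by metis

lemma computable_on_comp:
  assumes H: "computable_on \<X> (length Gs) H"
    and Gs: "\<And>G. G \<in> set Gs \<Longrightarrow> computable_on \<X> k G"
  shows "computable_on \<X> k (\<lambda>X xs. H X (map (\<lambda>G. G X xs) Gs))"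
proof -
  obtain h where h: "\<And>X xs. X \<in> \<X> \<Longrightarrow> length xs = length Gs \<Longrightarrow> evals X h xs (H X xs)"
    using H unfolding computable_on_def by metis
  obtain q where q: "\<And>G X xs. G \<in> set Gs \<Longrightarrow> X \<in> \<X> \<Longrightarrow> length xs = k \<Longrightarrow> evals X (q G) xs (G X xs)"
    using Gs unfolding computable_on_def by metis
  have "evals X (Comp h (map q Gs)) xs (H X (map (\<lambda>G. G X xs) Gs))"
    if "X \<in> \<X>" "length xs = k" for X xs
    using that by (intro evals.comp[where ys = "map (\<lambda>G. G X xs) Gs"] h)
      (auto simp: list_all2_map1 list_all2_map2 list_all2_same intro: q)
  then show ?thesis unfolding computable_on_def by blast
qed

lemma computable_on_const [computable_intros]: "computable_on \<X> k (\<lambda>X xs. n)"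
proof -
  have "\<exists>p. \<forall>X xs. evals X p xs n"
  proof (induction n)
    case 0
    show ?case using evals.zero by blast
  next
    case (Suc n)
    then obtain p where "\<forall>X xs. evals X p xs n" by blast
    then have "\<forall>X xs. evals X (Comp Succ [p]) xs (Suc n)"
      by (auto intro!: evals.comp[where ys = "[n]"] evals.succ)
    then show ?case by blast
  qed
  then show ?thesis unfolding computable_on_def by blast
qed

lemma computable_on_nth [computable_intros]: "i < k \<Longrightarrow> computable_on \<X> k (\<lambda>X xs. xs ! i)"
  unfolding computable_on_def using evals.proj by blast

lemma computable_on_nth_drop: "d + i < k \<Longrightarrow> computable_on \<X> k (\<lambda>X xs. drop d xs ! i)"
  by (rule computable_on_cong[OF computable_on_nth[of "d + i"]]) auto

lemma computable_on_hd_drop: "d < k \<Longrightarrow> computable_on \<X> k (\<lambda>X xs. hd (drop d xs))"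
  by (rule computable_on_cong[OF computable_on_nth[of d]]) (auto simp: hd_drop_conv_nth)

text \<open>Every binder of a search or quantifier pushes its variable onto the argument list, so
  variables occur as \<open>hd\<close> or \<open>!\<close> behind nested \<open>tl\<close>. The
  instances reach four binders deep, which is how deep \<open>stage\<close> in
  \<open>coding_step\<close> nests.\<close>

lemmas computable_on_vars [computable_intros] =
  computable_on_hd_drop[of 0, unfolded drop_0]
  computable_on_nth_drop[of "Suc 0", unfolded drop_Suc drop_0]
  computable_on_hd_drop[of "Suc 0", unfolded drop_Suc drop_0]
  computable_on_nth_drop[of "Suc (Suc 0)", unfolded drop_Suc drop_0]
  computable_on_hd_drop[of "Suc (Suc 0)", unfolded drop_Suc drop_0]
  computable_on_nth_drop[of "Suc (Suc (Suc 0))", unfolded drop_Suc drop_0]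
  computable_on_hd_drop[of "Suc (Suc (Suc 0))", unfolded drop_Suc drop_0]
  computable_on_nth_drop[of "Suc (Suc (Suc (Suc 0)))", unfolded drop_Suc drop_0]

text \<open>Weakening: the program is composed with the projections that skip the first
  \<open>d\<close> arguments.\<close>

lemma computable_on_drop:
  assumes "computable_on \<X> k F"
  shows "computable_on \<X> (d + k) (\<lambda>X xs. F X (drop d xs))"
proof -
  let ?Gs = "map (\<lambda>i (X::real_seq) xs. xs ! (d + i) :: nat) [0..<k]"
  have "computable_on \<X> (d + k) (\<lambda>X xs. F X (map (\<lambda>G. G X xs) ?Gs))"
    using assms by (intro computable_on_comp) (auto intro: computable_on_nth)
  then show ?thesis
  proof (rule computable_on_cong)
    fix X :: real_seq and xs :: "nat list"
    assume "length xs = d + k"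
    then have "map (\<lambda>G. G X xs) ?Gs = drop d xs"
      by (intro nth_equalityI) auto
    then show "F X (map (\<lambda>G. G X xs) ?Gs) = F X (drop d xs)" by simp
  qed
qed

lemma computable_on_tl: "computable_on \<X> k F \<Longrightarrow> computable_on \<X> (Suc k) (\<lambda>X xs. F X (tl xs))"
  using computable_on_drop[of \<X> k F "Suc 0"] by (simp add: drop_Suc)

lemma computable_on_tl_tl:
  "computable_on \<X> k F \<Longrightarrow> computable_on \<X> (Suc (Suc k)) (\<lambda>X xs. F X (tl (tl xs)))"
  by (intro computable_on_tl[of _ _ "\<lambda>X xs. F X (tl xs)"] computable_on_tl)

lemma computable_on_Cons:
  assumes "computable_on \<X> (Suc k) H" "computable_on \<X> k F"
  shows "computable_on \<X> k (\<lambda>X xs. H X (F X xs # xs))"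
proof -
  let ?Gs = "F # map (\<lambda>i (X::real_seq) xs. xs ! i :: nat) [0..<k]"
  have "computable_on \<X> k (\<lambda>X xs. H X (map (\<lambda>G. G X xs) ?Gs))"
    using assms by (intro computable_on_comp) (auto intro: computable_on_nth)
  then show ?thesis
  proof (rule computable_on_cong)
    fix X :: real_seq and xs :: "nat list"
    assume "length xs = k"
    then have "map (\<lambda>G. G X xs) ?Gs = F X xs # xs"
      by (auto intro!: nth_equalityI)
    then show "H X (map (\<lambda>G. G X xs) ?Gs) = H X (F X xs # xs)" by simp
  qed
qed

section \<open>Successor, oracle queries, primitive recursion and arithmetic\<close>

lemma computable_on_Suc [computable_intros]:
  assumes "computable_on \<X> k F"
  shows "computable_on \<X> k (\<lambda>X xs. Suc (F X xs))"
proof -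
  have "computable_on \<X> (length [F]) (\<lambda>X xs. Suc (xs ! 0))"
    unfolding computable_on_def
    by (rule exI[of _ Succ]) (auto simp: length_Suc_conv intro: evals.succ)
  from computable_on_comp[OF this, of k] assms show ?thesis by simp
qed

lemma decidable_on_oracle [computable_intros]:
  assumes "computable_on \<X> k F"
  shows "decidable_on \<X> k (\<lambda>X xs. X (F X xs))"
proof -
  have "decidable_on \<X> (length [F]) (\<lambda>X xs. X (xs ! 0))"
    unfolding computable_on_def
    by (rule exI[of _ Query]) (metis One_nat_def evals.query length_0_conv length_Suc_conv list.size(3,4) nth_Cons_0)
  from computable_on_comp[OF this, of k] assms show ?thesis by simp
qed

text \<open>\<open>Prec\<close> recurses on its first argument; \<open>computable_on_Cons\<close>
  puts the depth \<open>N\<close> there.\<close>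

lemma computable_on_rec_nat:
  assumes n: "computable_on \<X> k N" and F: "computable_on \<X> k F"
    and G: "computable_on \<X> (Suc (Suc k)) (\<lambda>X xs. G X (hd xs) (hd (tl xs)) (tl (tl xs)))"
  shows "computable_on \<X> k (\<lambda>X xs. rec_nat (F X xs) (\<lambda>n r. G X n r xs) (N X xs))"
proof -
  obtain f where f: "\<And>X xs. X \<in> \<X> \<Longrightarrow> length xs = k \<Longrightarrow> evals X f xs (F X xs)"
    using F unfolding computable_on_def by metis
  obtain g where g: "\<And>X xs. X \<in> \<X> \<Longrightarrow> length xs = Suc (Suc k)
      \<Longrightarrow> evals X g xs (G X (hd xs) (hd (tl xs)) (tl (tl xs)))"
    using G unfolding computable_on_def by metis
  have rec: "evals X (Prec f g) (n # xs) (rec_nat (F X xs) (\<lambda>n r. G X n r xs) n)"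
    if "X \<in> \<X>" "length xs = k" for X xs n
  proof (induction n)
    case 0
    show ?case using f[OF that] by (simp add: evals.prec_0)
  next
    case (Suc n)
    show ?case
      using evals.prec_Suc[OF Suc] g[OF that(1), of "n # _ # xs"] that(2) by simp
  qed
  have "computable_on \<X> (Suc k) (\<lambda>X xs. rec_nat (F X (tl xs)) (\<lambda>n r. G X n r (tl xs)) (hd xs))"
    unfolding computable_on_def
    by (rule exI[of _ "Prec f g"]) (auto simp: length_Suc_conv rec)
  from computable_on_Cons[OF this n] show ?thesis by simp
qed

lemma computable_on_add [computable_intros]:
  assumes "computable_on \<X> k F" "computable_on \<X> k G"
  shows "computable_on \<X> k (\<lambda>X xs. F X xs + G X xs)"
proof -
  have "rec_nat a (\<lambda>_. Suc) b = a + b" for a b :: nat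
    by (induction b) auto
  then show ?thesis
    using computable_on_rec_nat[OF assms(2,1), of "\<lambda>_ _ r _. Suc r"]
    by (simp add: computable_intros)
qed

lemma computable_on_mult [computable_intros]:
  assumes "computable_on \<X> k F" "computable_on \<X> k G"
  shows "computable_on \<X> k (\<lambda>X xs. F X xs * G X xs)"
proof -
  have "rec_nat 0 (\<lambda>_ r. r + a) b = a * b" for a b :: nat
    by (induction b) auto
  then show ?thesis
    using computable_on_rec_nat[OF assms(2) computable_on_const, of "\<lambda>X _ r xs. r + F X xs" 0]
      computable_on_tl_tl[OF assms(1)]
    by (simp add: computable_intros)
qed

lemma computable_on_diff [computable_intros]:
  assumes "computable_on \<X> k F" "computable_on \<X> k G"
  shows "computable_on \<X> k (\<lambda>X xs. F X xs - G X xs)"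
proof -
  have pred: "computable_on \<X> k' (\<lambda>X xs. H X xs - 1)" if "computable_on \<X> k' H" for k' H
  proof -
    have "rec_nat 0 (\<lambda>n _. n) b = b - 1" for b :: nat
      by (cases b) auto
    then show ?thesis
      using computable_on_rec_nat[OF that computable_on_const, of "\<lambda>_ n _ _. n" 0]
      by (simp add: computable_intros)
  qed
  have "rec_nat a (\<lambda>_ r. r - 1) b = a - b" for a b :: nat
    by (induction b) auto
  then show ?thesis
    using computable_on_rec_nat[OF assms(2,1), of "\<lambda>_ _ r _. r - 1"]
      pred[of "Suc (Suc k)" "\<lambda>_ xs. hd (tl xs)"]
    by (simp add: computable_intros)
qed

lemma computable_on_power2 [computable_intros]:
  assumes "computable_on \<X> k F"
  shows "computable_on \<X> k (\<lambda>X xs. 2 ^ F X xs)"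
proof -
  have "rec_nat 1 (\<lambda>_ r. r + r) b = (2 :: nat) ^ b" for b :: nat
    by (induction b) auto
  then show ?thesis
    using computable_on_rec_nat[OF assms computable_on_const, of "\<lambda>_ _ r _. r + r" 1]
    by (simp add: computable_intros)
qed

lemma computable_on_prod_encode [computable_intros]:
  assumes "computable_on \<X> k F" "computable_on \<X> k G"
  shows "computable_on \<X> k (\<lambda>X xs. prod_encode (F X xs, G X xs))"
proof -
  have "rec_nat 0 (\<lambda>n r. r + Suc n) b = triangle b" for b :: nat
    by (induction b) auto
  then have "computable_on \<X> k (\<lambda>X xs. triangle (F X xs + G X xs))"
    using computable_on_rec_nat[OF computable_on_add[OF assms] computable_on_const,
        of "\<lambda>_ n r _. r + Suc n" 0]
    by (simp add: computable_intros del: add_Suc_right)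
  then show ?thesis
    using assms by (simp add: prod_encode_def computable_intros)
qed

section \<open>Boolean operations and comparisons\<close>

lemma decidable_on_not [computable_intros]:
  assumes "decidable_on \<X> k P"
  shows "decidable_on \<X> k (\<lambda>X xs. \<not> P X xs)"
  by (rule computable_on_cong[OF computable_on_diff[OF computable_on_const[of _ _ 1] assms]]) simp

lemma decidable_on_conj [computable_intros]:
  assumes "decidable_on \<X> k P" "decidable_on \<X> k Q"
  shows "decidable_on \<X> k (\<lambda>X xs. P X xs \<and> Q X xs)"
  using computable_on_mult[OF assms] by (simp add: of_bool_conj)

lemma decidable_on_disj [computable_intros]:
  assumes "decidable_on \<X> k P" "decidable_on \<X> k Q"
  shows "decidable_on \<X> k (\<lambda>X xs. P X xs \<or> Q X xs)"
  using decidable_on_not[OF decidable_on_conj[OF assms[THEN decidable_on_not]]] by simp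

lemma decidable_on_imp [computable_intros]:
  assumes "decidable_on \<X> k P" "decidable_on \<X> k Q"
  shows "decidable_on \<X> k (\<lambda>X xs. P X xs \<longrightarrow> Q X xs)"
  by (rule computable_on_cong[OF decidable_on_disj[OF decidable_on_not[OF assms(1)] assms(2)]]) auto

lemma decidable_on_le [computable_intros]:
  assumes "computable_on \<X> k F" "computable_on \<X> k G"
  shows "decidable_on \<X> k (\<lambda>X xs. F X xs \<le> G X xs)"
proof -
  have "of_bool (a \<le> b) = 1 - (a - b)" for a b :: nat
    by auto
  then show ?thesis
    using computable_on_diff[OF computable_on_const computable_on_diff[OF assms], of 1] by simp
qed

lemma decidable_on_less [computable_intros]:
  assumes "computable_on \<X> k F" "computable_on \<X> k G"
  shows "decidable_on \<X> k (\<lambda>X xs. F X xs < G X xs)"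
  using decidable_on_not[OF decidable_on_le[OF assms(2,1)]] by (simp add: not_le)

lemma decidable_on_eq [computable_intros]:
  assumes "computable_on \<X> k F" "computable_on \<X> k G"
  shows "decidable_on \<X> k (\<lambda>X xs. F X xs = G X xs)"
  using decidable_on_conj[OF decidable_on_le[OF assms] decidable_on_le[OF assms(2,1)]]
  by (simp add: eq_iff)

section \<open>Unbounded search and bounded quantifiers\<close>

inductive_cases evals_CompE: "evals X (Comp p qs) xs z"
inductive_cases evals_MuE: "evals X (Mu p) xs n"

text \<open>\<open>Mu\<close> stops at the first zero, so \<open>q\<close> decides the negation of
  \<open>P\<close>. The equivalence also tells when the search diverges, which is what determines
  the domain of a machine.\<close>

lemma evals_Mu_search:
  assumes "\<And>u. evals X q (u # xs) (of_bool (\<not> P u))"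
  shows "evals X (Mu q) xs u \<longleftrightarrow> P u \<and> (\<forall>u'<u. \<not> P u')"
proof
  assume "evals X (Mu q) xs u"
  then show "P u \<and> (\<forall>u'<u. \<not> P u')"
  proof (rule evals_MuE)
    assume 0: "evals X q (u # xs) 0" and less: "\<forall>m<u. \<exists>k. evals X q (m # xs) (Suc k)"
    have "P u" using evals_deterministic[OF 0 assms] by (cases "P u") auto
    moreover have "\<not> P m" if "m < u" for m
      using less that evals_deterministic[OF assms[of m]] by (cases "P m") auto
    ultimately show ?thesis by blast
  qed
next
  assume "P u \<and> (\<forall>u'<u. \<not> P u')"
  then show "evals X (Mu q) xs u"
    using assms[of u] assms by (intro evals.mu) (auto, metis One_nat_def of_bool_eq(2))
qed

lemma decidable_on_search:
  assumes "decidable_on \<X> (Suc k) (\<lambda>X xs. P X (hd xs) (tl xs))"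
  obtains q where "\<And>X xs u. X \<in> \<X> \<Longrightarrow> length xs = k
    \<Longrightarrow> evals X q xs u \<longleftrightarrow> P X u xs \<and> (\<forall>u'<u. \<not> P X u' xs)"
proof -
  from decidable_on_not[OF assms] obtain q where
    "\<forall>X\<in>\<X>. \<forall>xs. length xs = Suc k \<longrightarrow> evals X q xs (of_bool (\<not> P X (hd xs) (tl xs)))"
    unfolding computable_on_def by blast
  then have "evals X q (u # xs) (of_bool (\<not> P X u xs))" if "X \<in> \<X>" "length xs = k" for X xs u
    using that by (metis length_Cons list.sel(1,3))
  from evals_Mu_search[OF this] that show thesis by blast
qed

lemma computable_on_Least [computable_intros]:
  assumes "decidable_on \<X> (Suc k) (\<lambda>X xs. P X (hd xs) (tl xs))"
    and ex: "\<And>X xs. X \<in> \<X> \<Longrightarrow> length xs = k \<Longrightarrow> \<exists>u. P X u xs"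
  shows "computable_on \<X> k (\<lambda>X xs. LEAST u. P X u xs)"
proof -
  obtain q where "\<And>X xs u. X \<in> \<X> \<Longrightarrow> length xs = k
      \<Longrightarrow> evals X q xs u \<longleftrightarrow> P X u xs \<and> (\<forall>u'<u. \<not> P X u' xs)"
    using decidable_on_search[OF assms(1)] by blast
  then have "evals X q xs (LEAST u. P X u xs)" if "X \<in> \<X>" "length xs = k" for X xs
    using ex[OF that] that by (metis LeastI not_less_Least)
  then show ?thesis unfolding computable_on_def by blast
qed

lemma decidable_on_ex_le [computable_intros]:
  assumes P: "decidable_on \<X> (Suc k) (\<lambda>X xs. P X (hd xs) (tl xs))"
    and B: "computable_on \<X> k B"
  shows "decidable_on \<X> k (\<lambda>X xs. \<exists>i\<le>B X xs. P X i xs)"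
proof -
  \<comment> \<open>The sentinel \<open>Suc (B X xs)\<close> makes the search total and is returned
    exactly when no witness lies within the bound.\<close>
  have "computable_on \<X> k (\<lambda>X xs. LEAST i. P X i xs \<or> i = Suc (B X xs))"
    by (intro computable_intros P computable_on_tl[OF B]) auto
  note decidable_on_le[OF this B]
  moreover have "(LEAST i. P i \<or> i = Suc b) \<le> b \<longleftrightarrow> (\<exists>i\<le>b. P i)" for P b
  proof
    assume "(LEAST i. P i \<or> i = Suc b) \<le> b"
    then show "\<exists>i\<le>b. P i"
      using LeastI[of "\<lambda>i. P i \<or> i = Suc b" "Suc b"] by auto
  next
    assume "\<exists>i\<le>b. P i"
    then show "(LEAST i. P i \<or> i = Suc b) \<le> b"
      by (metis (mono_tags, lifting) Least_le order_trans)
  qed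
  ultimately show ?thesis by simp
qed

lemma decidable_on_all_le [computable_intros]:
  assumes P: "decidable_on \<X> (Suc k) (\<lambda>X xs. P X (hd xs) (tl xs))"
    and B: "computable_on \<X> k B"
  shows "decidable_on \<X> k (\<lambda>X xs. \<forall>i\<le>B X xs. P X i xs)"
  by (rule computable_on_cong[OF decidable_on_not[OF decidable_on_ex_le[OF decidable_on_not[OF P] B]]])
    simp


lemma computable_on_apply3:
  assumes "computable_on \<X> 3 (\<lambda>X xs. H X (xs ! 0) (xs ! 1) (xs ! 2))"
    and "computable_on \<X> k F" "computable_on \<X> k G" "computable_on \<X> k G'"
  shows "computable_on \<X> k (\<lambda>X xs. H X (F X xs) (G X xs) (G' X xs))"
  using computable_on_comp[of \<X> "[F, G, G']" "\<lambda>X xs. H X (xs ! 0) (xs ! 1) (xs ! 2)" k] assms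
  by (auto simp: numeral_3_eq_3)

lemma computable_on_apply4:
  assumes "computable_on \<X> 4 H" "computable_on \<X> k F1" "computable_on \<X> k F2"
    "computable_on \<X> k F3" "computable_on \<X> k F4"
  shows "computable_on \<X> k (\<lambda>X xs. H X [F1 X xs, F2 X xs, F3 X xs, F4 X xs])"
  using computable_on_comp[of \<X> "[F1, F2, F3, F4]" H k] assms
  by (auto simp: eval_nat_numeral)


section \<open>Machines given by programs\<close>

lemma str_code_eq_iff [simp]: "str_code \<sigma> = str_code \<tau> \<longleftrightarrow> \<sigma> = \<tau>"
  using bij_str_code by (simp add: bij_def inj_eq)

lemma str_code_surj: obtains \<sigma> where "str_code \<sigma> = n"
  using bij_str_code by (metis bij_pointE)

definition machine :: "prog \<Rightarrow> oracle_machine" where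
  "machine p X \<sigma> = (if \<exists>\<tau>. evals X p [str_code \<sigma>] (str_code \<tau>)
     then Some (THE \<tau>. evals X p [str_code \<sigma>] (str_code \<tau>)) else None)"

lemma machine_eq_Some: "machine p X \<sigma> = Some \<tau> \<longleftrightarrow> evals X p [str_code \<sigma>] (str_code \<tau>)"
proof -
  have "(THE \<tau>. evals X p [str_code \<sigma>] (str_code \<tau>)) = \<tau>'"
    if "evals X p [str_code \<sigma>] (str_code \<tau>')" for \<tau>'
    using that by (intro the_equality) (metis evals_deterministic str_code_eq_iff)+
  then show ?thesis
    unfolding machine_def by auto
qed

text \<open>Since \<open>str_code\<close> is onto, every value of \<open>p\<close> is the code of a
  string, so halting of \<open>p\<close> is definedness of \<open>machine p\<close>. One
  \<open>\<rho>\<close> serves all oracles.\<close>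

lemma universal_machine_simulates:
  assumes "universal_machine U"
    and "\<And>X. prefix_free {\<sigma>. \<exists>y. evals X p [str_code \<sigma>] y}"
  obtains \<rho> where
    "\<And>X \<sigma> \<tau>. evals X p [str_code \<sigma>] (str_code \<tau>) \<Longrightarrow> U X (\<rho> @ \<sigma>) = Some \<tau>"
proof -
  have "dom (machine p X) = {\<sigma>. \<exists>y. evals X p [str_code \<sigma>] y}" for X
    unfolding dom_def by (auto simp: machine_eq_Some) (metis str_code_surj)
  then have "prefix_free_machine (machine p)"
    using assms(2) machine_eq_Some unfolding prefix_free_machine_def by metis
  then show thesis
    using assms(1) that machine_eq_Some unfolding universal_machine_def by metis
qed

lemma KO_le: "U X \<pi> = Some \<sigma> \<Longrightarrow> KO U X \<sigma> \<le> length \<pi>"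
  unfolding KO_def by (rule Least_le) blast

section \<open>Self-delimiting unary headers\<close>

text \<open>A leading \<open>True\<close> doubles the code plus 2, and a leading
  \<open>False\<close> turns a code \<open>c\<close> into \<open>2 * c + 1\<close>. Parsing a header
  thus becomes arithmetic on codes.\<close>

lemma str_code_unary_header:
  "str_code (replicate j True @ False # \<pi>) + 2 = 2 ^ j * (2 * str_code \<pi> + 3)"
  by (induction j) auto

lemma str_code_unary_headerD:
  assumes "str_code \<sigma> + 2 = 2 ^ j * (2 * str_code \<pi> + 3)"
  shows "\<sigma> = replicate j True @ False # \<pi>"
  using assms str_code_unary_header[of j \<pi>] by (metis add_right_cancel str_code_eq_iff)

lemma prefix_unary_header:
  "prefix (replicate i True @ False # \<sigma>) (replicate j True @ False # \<tau>) \<longleftrightarrow> i = j \<and> prefix \<sigma> \<tau>"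
proof (induction i arbitrary: j)
  case 0
  then show ?case by (cases j) auto
next
  case (Suc i)
  then show ?case by (cases j) auto
qed

lemma unary_header_eq_iff:
  "replicate i True @ False # \<sigma> = replicate j True @ False # \<tau> \<longleftrightarrow> i = j \<and> \<sigma> = \<tau>"
  using prefix_unary_header[of i \<sigma> j \<tau>] by auto

text \<open>Headers \<open>1^j 0\<close> delimit themselves, so comparable strings share their
  header and have comparable bodies in \<open>E\<close>. As \<open>D\<close> is only required to be
  included, an upper estimate of a machine's domain is enough.\<close>

lemma prefix_free_unary_header:
  assumes "prefix_free E" "D \<subseteq> (\<Union>j. (\<lambda>\<pi>. replicate j True @ False # \<pi>) ` E)"
  shows "prefix_free D"
  unfolding prefix_free_def
proof (intro ballI impI)
  fix \<sigma> \<tau>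
  assume *: "\<sigma> \<in> D" "\<tau> \<in> D" "prefix \<sigma> \<tau>"
  then obtain i \<pi> j \<pi>' where "\<sigma> = replicate i True @ False # \<pi>" "\<pi> \<in> E"
    "\<tau> = replicate j True @ False # \<pi>'" "\<pi>' \<in> E"
    using assms(2) by blast
  then show "\<sigma> = \<tau>"
    using assms(1) * by (auto simp: prefix_unary_header prefix_free_def)
qed

text \<open>Rests on \<open>i + 1 \<le> 2 ^ i\<close>. It justifies bounding the quantifiers by the
  code when a header is parsed.\<close>

lemma unary_index_le:
  assumes "c + 2 = 2 ^ i * (d + 3 :: nat)"
  shows "i \<le> c" "d \<le> c"
proof -
  have *: "i + 1 \<le> 2 ^ i"
    by (simp add: Suc_leI)
  then have "(i + 1) * (d + 3) \<le> c + 2"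
    unfolding assms by (rule mult_le_mono1)
  then show "i \<le> c" "d \<le> c"
    by (auto simp: algebra_simps)
qed

text \<open>A machine sending \<open>1^k 0\<close> to the string with code \<open>k\<close>
  describes every string under every oracle; hence the minimum in \<open>KO\<close> exists.\<close>

lemma universal_machine_describes:
  assumes "universal_machine U"
  shows "\<exists>\<pi>. U X \<pi> = Some \<sigma>"
proof -
  \<comment> \<open>\<open>2 ^ k * 3\<close> is the code of \<open>1^k 0\<close> plus 2, the body
    after the header being empty.\<close>
  have "decidable_on UNIV (Suc 1) (\<lambda>X xs. tl xs ! 0 + 2 = 2 ^ hd xs * 3)"
    by (intro computable_intros) auto
  then obtain q where q: "\<And>(X :: real_seq) xs u. length xs = 1 \<Longrightarrow> evals X q xs u \<longleftrightarrow>
      xs ! 0 + 2 = 2 ^ u * 3 \<and> (\<forall>u'<u. xs ! 0 + 2 \<noteq> 2 ^ u' * 3)"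
    by (rule decidable_on_search) auto
  have "prefix_free {\<sigma>. \<exists>y. evals X q [str_code \<sigma>] y}" for X
  proof (rule prefix_free_unary_header[of "{[]}"])
    show "{\<sigma>. \<exists>y. evals X q [str_code \<sigma>] y} \<subseteq> (\<Union>j. (\<lambda>\<pi>. replicate j True @ False # \<pi>) ` {[]})"
      using str_code_unary_headerD[of _ _ "[]"] by (auto simp: q)
  qed (simp add: prefix_free_def)
  then obtain \<rho> where "\<And>X \<sigma> \<tau>. evals X q [str_code \<sigma>] (str_code \<tau>) \<Longrightarrow> U X (\<rho> @ \<sigma>) = Some \<tau>"
    using universal_machine_simulates[OF assms] by blast
  moreover have "evals X q [str_code (replicate (str_code \<sigma>) True @ [False])] (str_code \<sigma>)"
    using str_code_unary_header[of "str_code \<sigma>" "[]"] by (simp add: q)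
  ultimately show ?thesis by blast
qed

lemma KO_attained:
  assumes "universal_machine U"
  obtains \<pi> where "U X \<pi> = Some \<sigma>" "length \<pi> = KO U X \<sigma>"
proof -
  have "\<exists>n \<pi>. length \<pi> = n \<and> U X \<pi> = Some \<sigma>"
    using universal_machine_describes[OF assms] by blast
  from LeastI_ex[OF this] show thesis
    using that unfolding KO_def by blast
qed

section \<open>Codes of initial segments\<close>

lemma str_code_eq_sum: "str_code xs = (\<Sum>i<length xs. 2 ^ i * (if xs ! i then 2 else 1))"
  by (induction xs) (auto simp: sum.lessThan_Suc_shift sum_distrib_left mult.assoc simp del: sum.lessThan_Suc)

text \<open>Position \<open>i\<close> has digit 1 or 2: it contributes \<open>2 ^ i\<close>, and
  once more if \<open>i\<close> is in \<open>E\<close>. Passing from the code of \<open>0^n\<close>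
  to that of the segment therefore adds the same number for all large \<open>n\<close>.\<close>

lemma str_code_initial_segment:
  assumes "E \<subseteq> {..<n}"
  shows "str_code (initial_segment (\<lambda>x. x \<in> E) n) + 1 = 2 ^ n + (\<Sum>q\<in>E. 2 ^ q)"
proof -
  have "str_code (initial_segment (\<lambda>x. x \<in> E) n) = (\<Sum>i<n. 2 ^ i * (if i \<in> E then 2 else 1))"
    unfolding str_code_eq_sum initial_segment_def by (intro sum.cong) auto
  also have "\<dots> = (\<Sum>i<n. 2 ^ i + (if i \<in> E then 2 ^ i else 0))"
    by (intro sum.cong) auto
  also have "\<dots> = (\<Sum>i<n. 2 ^ i) + (\<Sum>q\<in>E. 2 ^ q)"
    using assms by (simp add: sum.distrib sum.If_cases Int_absorb1)
  finally have "str_code (initial_segment (\<lambda>x. x \<in> E) n) = (\<Sum>i<n. 2 ^ i) + (\<Sum>q\<in>E. 2 ^ q)" .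
  moreover have "(\<Sum>i<n. 2 ^ i) + 1 = (2 ^ n :: nat)"
    by (induction n) auto
  ultimately show ?thesis by simp
qed

lemma str_code_replicate_False: "str_code (replicate n False) + 1 = 2 ^ n"
  by (induction n) auto


section \<open>Computable lower bounds for \<open>\<Delta>\<^sup>0\<^sub>2\<close> orders\<close>

text \<open>\<open>Q j z b\<close> says that \<open>z\<close>, as a witness for \<open>j \<le> g z\<close>, has survived the test with \<open>b\<close>.\<close>

lemma Delta02_order_test:
  assumes "order_fun g" "Delta02_fun g"
  obtains Q where "decidable_on {\<lambda>_. False} 3 (\<lambda>X xs. Q (xs ! 0) (xs ! 1) (xs ! 2))"
    and "\<And>j. \<exists>z. \<forall>b. Q j z b" and "\<And>j z. \<forall>b. Q j z b \<Longrightarrow> j \<le> g z"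
proof -
  obtain S where S: "computable_rel 4 S"
    and g: "\<And>x y. g x = y \<longleftrightarrow> (\<exists>a. \<forall>b. S [a, b, x, y])"
  proof -
    obtain S where "computable_rel (2 + 2) S"
      and *: "\<forall>xs. length xs = 2 \<longrightarrow> (g (xs ! 0) = xs ! 1 \<longleftrightarrow> (\<exists>a. \<forall>b. S (a # b # xs)))"
      using assms(2) unfolding Delta02_fun_def Delta02_def Sigma02_def by blast
    moreover have "g x = y \<longleftrightarrow> (\<exists>a. \<forall>b. S [a, b, x, y])" for x y
      using *[rule_format, of "[x, y]"] by simp
    ultimately show thesis
      using that[of S] by simp
  qed
  \<comment> \<open>\<open>z\<close> encodes a claim \<open>g x = y\<close> with
    \<open>j \<le> y\<close> and its outer witness \<open>a\<close>. A code dominates its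
    components, so the quantifiers can be bounded by \<open>z\<close>.\<close>
  define Q where "Q j z b \<longleftrightarrow> (\<exists>x\<le>z. \<exists>y\<le>z. \<exists>a\<le>z. z = prod_encode (x, prod_encode (y, a)) \<and>
    j \<le> y \<and> S [a, b, x, y])" for j z b
  show thesis
  proof (rule that)
    have "decidable_on {\<lambda>_. False} 4 (\<lambda>X. S)"
      using S unfolding computable_rel_def computable_on_def by simp
    note S' = computable_on_apply4[OF this]
    show "decidable_on {\<lambda>_. False} 3 (\<lambda>X xs. Q (xs ! 0) (xs ! 1) (xs ! 2))"
      unfolding Q_def by (intro computable_intros S'; simp)
    show "\<exists>z. \<forall>b. Q j z b" for j
    proof -
      obtain x where "j \<le> g x"
        using assms(1) unfolding order_fun_def bdd_above_def by (metis nat_le_linear rangeE)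
      moreover obtain a where "\<forall>b. S [a, b, x, g x]"
        using g by blast
      moreover have "x \<le> prod_encode (x, prod_encode (g x, a))"
        "g x \<le> prod_encode (x, prod_encode (g x, a))" "a \<le> prod_encode (x, prod_encode (g x, a))"
        by (rule le_prod_encode_1, rule order_trans[OF le_prod_encode_1 le_prod_encode_2],
          rule order_trans[OF le_prod_encode_2 le_prod_encode_2])
      ultimately show ?thesis unfolding Q_def by blast
    qed
    show "j \<le> g z" if Q: "\<forall>b. Q j z b" for j z
    proof -
      obtain x y a where z: "z = prod_encode (x, prod_encode (y, a))" "x \<le> z" "j \<le> y"
        using Q unfolding Q_def by blast
      have "S [a, b, x, y]" for b
        using Q z(1) unfolding Q_def by (metis Pair_inject prod_encode_eq)
      then have "g x = y" using g by blast
      \<comment> \<open>\<open>j \<le> y = g x \<le> g z\<close>, by monotonicity and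
        \<open>x \<le> z\<close>.\<close>
      then show ?thesis
        using z assms(1) unfolding order_fun_def mono_def by (metis order_trans)
    qed
  qed
qed

text \<open>Induction on \<open>G\<close>: a joint witness is a pair of witnesses, both tested with
  the same \<open>b\<close>. A pair dominates its components, so monotonicity transfers their lower
  bounds to it.\<close>

lemma Delta02_orders_test:
  assumes "finite G" "\<forall>g\<in>G. order_fun g \<and> Delta02_fun g"
  shows "\<exists>Q. decidable_on {\<lambda>_. False} 3 (\<lambda>X xs. Q (xs ! 0) (xs ! 1) (xs ! 2)) \<and>
    (\<forall>j. \<exists>z. \<forall>b. Q j z b) \<and> (\<forall>j z. (\<forall>b. Q j z b) \<longrightarrow> (\<forall>g\<in>G. j \<le> g z))"
  using assms
proof (induction G)
  case empty
  show ?case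
    by (rule exI[of _ "\<lambda>_ _ _. True"]) (simp add: computable_on_const)
next
  case (insert g G)
  have "\<exists>Q. decidable_on {\<lambda>_. False} 3 (\<lambda>X xs. Q (xs ! 0) (xs ! 1) (xs ! 2)) \<and>
    (\<forall>j. \<exists>z. \<forall>b. Q j z b) \<and> (\<forall>j z. (\<forall>b. Q j z b) \<longrightarrow> (\<forall>g\<in>G. j \<le> g z))"
    using insert.IH insert.prems by simp
  then obtain Q where Q: "decidable_on {\<lambda>_. False} 3 (\<lambda>X xs. Q (xs ! 0) (xs ! 1) (xs ! 2))"
    "\<forall>j. \<exists>z. \<forall>b. Q j z b" "\<forall>j z. (\<forall>b. Q j z b) \<longrightarrow> (\<forall>g\<in>G. j \<le> g z)"
    by (elim exE conjE)
  obtain R where R: "decidable_on {\<lambda>_. False} 3 (\<lambda>X xs. R (xs ! 0) (xs ! 1) (xs ! 2))"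
    "\<And>j. \<exists>z. \<forall>b. R j z b" "\<And>j z. \<forall>b. R j z b \<Longrightarrow> j \<le> g z"
    using Delta02_order_test[of g] insert.prems by auto
  define T where "T j z b \<longleftrightarrow> (\<exists>x\<le>z. \<exists>y\<le>z. z = prod_encode (x, y) \<and> Q j x b \<and> R j y b)" for j z b
  have "decidable_on {\<lambda>_. False} 3 (\<lambda>X xs. T (xs ! 0) (xs ! 1) (xs ! 2))"
    unfolding T_def
    by (intro computable_intros computable_on_apply3[OF Q(1)] computable_on_apply3[OF R(1)]; simp)
  moreover have "\<exists>z. \<forall>b. T j z b" for j
  proof -
    obtain x y where "\<forall>b. Q j x b" "\<forall>b. R j y b"
      using Q(2) R(2) by blast
    moreover have "x \<le> prod_encode (x, y)" "y \<le> prod_encode (x, y)"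
      by (rule le_prod_encode_1, rule le_prod_encode_2)
    ultimately show ?thesis unfolding T_def by blast
  qed
  moreover have "\<forall>h\<in>insert g G. j \<le> h z" if T: "\<forall>b. T j z b" for j z
  proof -
    obtain x y where z: "z = prod_encode (x, y)" "x \<le> z" "y \<le> z"
      using T unfolding T_def by blast
    have "Q j x b \<and> R j y b" for b
      using T z(1) unfolding T_def by (metis Pair_inject prod_encode_eq)
    then have "\<forall>h\<in>G. j \<le> h x" "j \<le> g y"
      using Q(3) R(3) by auto
    moreover have "mono h" if "h \<in> insert g G" for h
      using insert.prems that by (auto simp: order_fun_def)
    ultimately show ?thesis
      using z by (auto simp: mono_def intro: order_trans)
  qed
  ultimately show ?case by blast
qed

text \<open>\<open>u\<close> bounds the least correct witness \<open>w\<close> and the tests refuting all smaller candidates.  The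
  disjunct \<open>s = v\<close> only makes the search total.\<close>

lemma limit_modulus:
  fixes R :: "nat \<Rightarrow> nat \<Rightarrow> bool"
  assumes "\<exists>z. \<forall>b. R z b"
  obtains u w where "w \<le> u" "\<forall>b. R w b" "\<And>v. u \<le> v \<Longrightarrow>
    (LEAST s. s = v \<or> (\<exists>w\<le>s. (\<forall>b\<le>v. R w b) \<and> (\<forall>z\<le>w. z < w \<longrightarrow> (\<exists>b\<le>s. \<not> R z b)))) = u"
proof -
  define w where "w = (LEAST z. \<forall>b. R z b)"
  have w: "\<forall>b. R w b"
    using LeastI_ex[OF assms] unfolding w_def .
  have "\<forall>z. \<exists>b. z < w \<longrightarrow> \<not> R z b"
    using not_less_Least[of _ "\<lambda>z. \<forall>b. R z b"] unfolding w_def by blast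
  then obtain r where r: "\<And>z. z < w \<Longrightarrow> \<not> R z (r z)" by metis
  define V where "V s \<longleftrightarrow> w \<le> s \<and> (\<forall>z<w. \<exists>b\<le>s. \<not> R z b)" for s
  \<comment> \<open>The tests refuting the finitely many candidates below \<open>w\<close> are
    bounded by their sum, so some \<open>s\<close> satisfies \<open>V\<close>.\<close>
  have "r z \<le> w + (\<Sum>z<w. r z)" if "z < w" for z
    using that member_le_sum[of z "{..<w}" r] by simp
  with r have "V (w + (\<Sum>z<w. r z))"
    unfolding V_def by (meson le_add1)
  then have V: "V (LEAST s. V s)" by (rule LeastI)
  define u where "u = (LEAST s. V s)"
  have wu: "w \<le> u" and u: "\<And>z. z < w \<Longrightarrow> \<exists>b\<le>u. \<not> R z b"
    using V[folded u_def] unfolding V_def by blast+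
  have "(LEAST s. s = v \<or> (\<exists>w\<le>s. (\<forall>b\<le>v. R w b) \<and> (\<forall>z\<le>w. z < w \<longrightarrow> (\<exists>b\<le>s. \<not> R z b)))) = u"
    if v: "u \<le> v" for v
  proof (rule Least_equality)
    show "u = v \<or> (\<exists>w\<le>u. (\<forall>b\<le>v. R w b) \<and> (\<forall>z\<le>w. z < w \<longrightarrow> (\<exists>b\<le>u. \<not> R z b)))"
      using w wu u by (intro disjI2 exI[of _ w]) simp
    fix s
    assume "s = v \<or> (\<exists>w\<le>s. (\<forall>b\<le>v. R w b) \<and> (\<forall>z\<le>w. z < w \<longrightarrow> (\<exists>b\<le>s. \<not> R z b)))"
    then show "u \<le> s"
    proof
      assume "\<exists>w\<le>s. (\<forall>b\<le>v. R w b) \<and> (\<forall>z\<le>w. z < w \<longrightarrow> (\<exists>b\<le>s. \<not> R z b))"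
      then obtain w' where w': "w' \<le> s" "\<forall>b\<le>v. R w' b" "\<forall>z<w'. \<exists>b\<le>s. \<not> R z b"
        by (meson less_imp_le)
      \<comment> \<open>A candidate below \<open>w\<close> is refuted by a test up to
        \<open>u \<le> v\<close>; one above \<open>w\<close> would require a refutation of the
        correct \<open>w\<close>. Hence \<open>w' = w\<close>.\<close>
      have "\<not> w' < w"
        using u v w'(2) by (meson order_trans)
      moreover have "\<not> w < w'"
        using w w'(3) by blast
      ultimately have "V s"
        using w' unfolding V_def by (metis linorder_neqE_nat)
      then show ?thesis unfolding u_def by (rule Least_le)
    qed (use v in simp)
  qed
  with wu w show thesis
    using that by blast
qed


section \<open>Coding into a real\<close>

text \<open>One step of the construction. The decoder has \<open>E\<close> and \<open>a\<close>
  built in but reads \<open>j\<close> from its input, so \<open>j\<close> can be chosen after the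
  decoder's coding prefix \<open>\<rho>\<close> is known and pay for it.\<close>

lemma coding_step:
  assumes U: "universal_machine U" and E: "finite E"
    and G: "finite G" "\<forall>g\<in>G. order_fun g \<and> Delta02_fun g"
  obtains m where "\<forall>q\<in>E. q < prod_encode (a, m)"
    and "\<forall>n>prod_encode (a, m). \<forall>g\<in>G.
      K U (initial_segment (\<lambda>x. x \<in> insert (prod_encode (a, m)) E) n) \<le> K_nat U n + g (prod_encode (a, m))"
proof -
  obtain Q where Q: "decidable_on {\<lambda>_. False} 3 (\<lambda>X xs. Q (xs ! 0) (xs ! 1) (xs ! 2))"
    "\<And>j. \<exists>z. \<forall>b. Q j z b" "\<And>j z g. \<forall>b. Q j z b \<Longrightarrow> g \<in> G \<Longrightarrow> j \<le> g z"
    using Delta02_orders_test[OF G] by (elim exE conjE) simp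
  \<comment> \<open>\<open>B\<close> exceeds every element of \<open>E\<close>, so adding it to the
    padding places the new element above \<open>E\<close>.\<close>
  define B where "B = Suc (\<Sum>q\<in>E. q)"
  \<comment> \<open>The stage of \<open>limit_modulus\<close> as guessed from the tests up to
    \<open>v\<close>; it is constant for large \<open>v\<close>.\<close>
  define stage where "stage j v = (LEAST s. s = v \<or> (\<exists>w\<le>s. (\<forall>b\<le>v. Q j w b) \<and>
    (\<forall>z\<le>w. z < w \<longrightarrow> (\<exists>b\<le>s. \<not> Q j z b))))" for j v
  \<comment> \<open>With \<open>v\<close> the code of \<open>0^n\<close>, this value is the code of
    the wanted segment as soon as the guessed stage is right. The test level is \<open>2 * j\<close>
    because the description will cost \<open>2 * j\<close> extra bits.\<close>
  have "computable_on {\<lambda>_. False} 2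
    (\<lambda>X xs. xs ! 1 + (\<Sum>q\<in>E. 2 ^ q) + 2 ^ prod_encode (a, stage (2 * xs ! 0) (xs ! 1) + B))"
    unfolding stage_def by (intro computable_intros computable_on_apply3[OF Q(1)]; force)
  then obtain h where "\<And>xs. length xs = 2 \<Longrightarrow> evals (\<lambda>_. False) h xs
      (xs ! 1 + (\<Sum>q\<in>E. 2 ^ q) + 2 ^ prod_encode (a, stage (2 * xs ! 0) (xs ! 1) + B))"
    unfolding computable_on_def by blast
  from this[of "[_, _]"] have h: "evals (\<lambda>_. False) h [j, v]
      (v + (\<Sum>q\<in>E. 2 ^ q) + 2 ^ prod_encode (a, stage (2 * j) v + B))" for j v
    by simp
  obtain pU where pU: "\<And>X \<sigma> \<tau>. U X \<sigma> = Some \<tau> \<longleftrightarrow> evals X pU [str_code \<sigma>] (str_code \<tau>)"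
    using U unfolding universal_machine_def prefix_free_machine_def by blast
  \<comment> \<open>\<open>qj\<close> and \<open>qy\<close> split the code of
    \<open>1^j 0 \<pi>\<close> into \<open>j\<close> and the code of \<open>\<pi>\<close>.\<close>
  have "decidable_on UNIV (Suc 1) (\<lambda>X xs. \<exists>y\<le>tl xs ! 0. tl xs ! 0 + 2 = 2 ^ hd xs * (2 * y + 3))"
    by (intro computable_intros; simp)
  then obtain qj where qj: "\<And>(X :: real_seq) xs u. length xs = 1 \<Longrightarrow> evals X qj xs u \<longleftrightarrow>
      (\<exists>y\<le>xs ! 0. xs ! 0 + 2 = 2 ^ u * (2 * y + 3)) \<and>
      (\<forall>u'<u. \<not> (\<exists>y\<le>xs ! 0. xs ! 0 + 2 = 2 ^ u' * (2 * y + 3)))"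
    by (rule decidable_on_search) auto
  have "decidable_on UNIV (Suc 1) (\<lambda>X xs. \<exists>j\<le>tl xs ! 0. tl xs ! 0 + 2 = 2 ^ j * (2 * hd xs + 3))"
    by (intro computable_intros; simp)
  then obtain qy where qy: "\<And>(X :: real_seq) xs u. length xs = 1 \<Longrightarrow> evals X qy xs u \<longleftrightarrow>
      (\<exists>j\<le>xs ! 0. xs ! 0 + 2 = 2 ^ j * (2 * u + 3)) \<and>
      (\<forall>u'<u. \<not> (\<exists>j\<le>xs ! 0. xs ! 0 + 2 = 2 ^ j * (2 * u' + 3)))"
    by (rule decidable_on_search) auto
  have header_unique: "i = j \<and> y = z" if eq: "2 ^ i * (2 * y + 3) = 2 ^ j * (2 * z + 3 :: nat)" for i j y z
  proof -
    obtain \<sigma> \<tau> where "str_code \<sigma> = y" "str_code \<tau> = z" by (metis str_code_surj)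
    then show ?thesis
      using eq str_code_unary_headerD[of "replicate i True @ False # \<sigma>" j \<tau>]
        str_code_unary_header[of i \<sigma>] by (auto simp: unary_header_eq_iff)
  qed
  \<comment> \<open>On \<open>1^j 0 \<pi>\<close>, \<open>N\<close> runs \<open>U\<close> on
    \<open>\<pi>\<close> and hands \<open>j\<close> and the result to \<open>h\<close>.\<close>
  define N where "N = Comp h [qj, Comp pU [qy]]"
  \<comment> \<open>\<open>h\<close> is specified for the empty oracle only. Under any oracle,
    however, \<open>N\<close> halts only if \<open>U\<close> halts on \<open>\<pi>\<close>, and this
    already gives prefix-freeness.\<close>
  have "prefix_free {\<sigma>. \<exists>y. evals X N [str_code \<sigma>] y}" for X
  proof (rule prefix_free_unary_header)
    show "prefix_free (dom (U X))"
      using U unfolding universal_machine_def prefix_free_machine_def by blast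
    show "{\<sigma>. \<exists>y. evals X N [str_code \<sigma>] y} \<subseteq> (\<Union>j. (\<lambda>\<pi>. replicate j True @ False # \<pi>) ` dom (U X))"
    proof
      fix \<sigma>
      assume "\<sigma> \<in> {\<sigma>. \<exists>y. evals X N [str_code \<sigma>] y}"
      then obtain v y where *: "evals X qy [str_code \<sigma>] y" "evals X pU [y] v"
        unfolding N_def by (auto elim!: evals_CompE simp: list_all2_Cons1)
      obtain j where "str_code \<sigma> + 2 = 2 ^ j * (2 * y + 3)"
        using *(1) by (auto simp: qy)
      moreover obtain \<pi> \<tau> where "str_code \<pi> = y" "str_code \<tau> = v"
        by (metis str_code_surj)
      ultimately have "\<sigma> = replicate j True @ False # \<pi>" "\<pi> \<in> dom (U X)"
        using str_code_unary_headerD *(2) pU by blast+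
      then show "\<sigma> \<in> (\<Union>j. (\<lambda>\<pi>. replicate j True @ False # \<pi>) ` dom (U X))" by blast
    qed
  qed
  then obtain \<rho> where \<rho>: "\<And>X \<sigma> \<tau>. evals X N [str_code \<sigma>] (str_code \<tau>) \<Longrightarrow> U X (\<rho> @ \<sigma>) = Some \<tau>"
    using universal_machine_simulates[OF U] by blast
  \<comment> \<open>The header \<open>1\<^sup>j0\<close> and the coding prefix \<open>\<rho>\<close> then cost \<open>2 * j\<close> bits together.\<close>
  define j where "j = length \<rho> + 1"
  obtain u w where u: "w \<le> u" "\<forall>b. Q (2 * j) w b" "\<And>v. u \<le> v \<Longrightarrow> stage (2 * j) v = u"
    by (rule limit_modulus[of "Q (2 * j)", folded stage_def]) (use Q(2) in blast)+
  define p where "p = prod_encode (a, u + B)"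
  have up: "u + B \<le> p"
    unfolding p_def by (rule le_prod_encode_2)
  have Ep: "q < p" if "q \<in> E" for q
    using member_le_sum[OF that, of "\<lambda>q. q"] E up unfolding B_def by simp
  have "K U (initial_segment (\<lambda>x. x \<in> insert p E) n) \<le> K_nat U n + g p" if n: "p < n" and g: "g \<in> G" for n g
  proof -
    obtain \<pi> where \<pi>: "U (\<lambda>_. False) \<pi> = Some (replicate n False)" "length \<pi> = K_nat U n"
      unfolding K_nat_def K_def using KO_attained[OF U] by blast
    define v where "v = str_code (replicate n False)"
    have v: "v + 1 = 2 ^ n"
      unfolding v_def by (rule str_code_replicate_False)
    \<comment> \<open>\<open>u \<le> p < n \<le> 2 ^ n - 1 = v\<close>, so the stage guessed from
      \<open>v\<close> is \<open>u\<close>.\<close>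
    then have "u \<le> v"
      using less_exp[of n] n up by linarith
    define c where "c = str_code (replicate j True @ False # \<pi>)"
    have c: "c + 2 = 2 ^ j * (2 * str_code \<pi> + 3)"
      unfolding c_def by (rule str_code_unary_header)
    have bounds: "j \<le> c" "str_code \<pi> \<le> c"
      using unary_index_le[OF c] by auto
    have unique: "i = j \<and> y = str_code \<pi>" if "c + 2 = 2 ^ i * (2 * y + 3)" for i y
      using header_unique[OF trans[OF that[symmetric] c]] .
    have "evals X qj [c] j" for X
      by (subst qj, simp, unfold nth_Cons_0) (use c bounds unique in blast)
    moreover have "evals X qy [c] (str_code \<pi>)" for X
      by (subst qy, simp, unfold nth_Cons_0) (use c bounds unique in blast)
    moreover have "evals (\<lambda>_. False) pU [str_code \<pi>] v"
      using \<pi>(1) pU unfolding v_def by blast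
    ultimately have N: "evals (\<lambda>_. False) N [c] (v + (\<Sum>q\<in>E. 2 ^ q) + 2 ^ prod_encode (a, stage (2 * j) v + B))"
      unfolding N_def
      by (intro evals.comp[where ys = "[j, v]"] h) (auto intro!: evals.comp[where ys = "[str_code \<pi>]"])
    have "insert p E \<subseteq> {..<n}" "p \<notin> E"
      using Ep n by (auto intro: less_trans)
    from str_code_initial_segment[OF this(1)] this(2)
    have "str_code (initial_segment (\<lambda>x. x \<in> insert p E) n) = v + (\<Sum>q\<in>E. 2 ^ q) + 2 ^ p"
      using v E by simp
    with N have "evals (\<lambda>_. False) N [c] (str_code (initial_segment (\<lambda>x. x \<in> insert p E) n))"
      using u(3)[OF \<open>u \<le> v\<close>] by (simp add: p_def)
    then have "K U (initial_segment (\<lambda>x. x \<in> insert p E) n) \<le> length (\<rho> @ replicate j True @ False # \<pi>)"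
      unfolding K_def c_def by (intro KO_le \<rho>)
    also have "\<dots> = 2 * j + K_nat U n"
      using \<pi>(2) unfolding j_def by simp
    also have "2 * j \<le> g w"
      using Q(3) u(2) g by blast
    also have "g w \<le> g p"
      using G(2) g u(1) up by (auto simp: order_fun_def intro!: monoD[of g])
    finally show ?thesis by simp
  qed
  then show thesis
    using that[of "u + B"] Ep unfolding p_def by blast
qed

section \<open>Reading the coded strings from the oracle\<close>

text \<open>On \<open>1^i 0\<close> a machine searches the oracle for an element starting with some
  \<open>(i, t)\<close> and outputs the string with code \<open>t\<close>. By the uniqueness
  assumption any such element is right; the constant depends on the machine alone.\<close>

lemma decoding:
  assumes U: "universal_machine U"
  obtains c where "\<And>A i \<sigma>. \<exists>m. A (prod_encode (prod_encode (i, str_code \<sigma>), m)) \<Longrightarrow>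
    (\<And>t m. A (prod_encode (prod_encode (i, t), m)) \<Longrightarrow> t = str_code \<sigma>) \<Longrightarrow> KO U A \<sigma> \<le> i + c"
proof -
  define W where "W X c t u \<longleftrightarrow> (\<exists>i\<le>c. c + 2 = 2 ^ i * 3 \<and>
    (\<exists>m\<le>u. X (prod_encode (prod_encode (i, t), m))))" for X :: real_seq and c t u :: nat
  have "decidable_on UNIV (Suc 1) (\<lambda>X xs. \<exists>t\<le>hd xs. W X (tl xs ! 0) t (hd xs))"
    unfolding W_def by (intro computable_intros; simp)
  then obtain q where q: "\<And>(X :: real_seq) xs u. length xs = 1 \<Longrightarrow> evals X q xs u \<longleftrightarrow>
      (\<exists>t\<le>u. W X (xs ! 0) t u) \<and> (\<forall>u'<u. \<not> (\<exists>t\<le>u'. W X (xs ! 0) t u'))"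
    by (rule decidable_on_search) auto
  \<comment> \<open>Once the unbounded search \<open>q\<close> has found \<open>u\<close>, reading
    off \<open>t\<close> is a bounded search, and the default \<open>t = u\<close> makes it
    total.\<close>
  have "computable_on UNIV 2 (\<lambda>X xs. LEAST t. t = xs ! 0 \<or> W X (xs ! 1) t (xs ! 0))"
    unfolding W_def by (intro computable_intros; force)
  then obtain h where "\<And>X xs. length xs = 2
      \<Longrightarrow> evals X h xs (LEAST t. t = xs ! 0 \<or> W X (xs ! 1) t (xs ! 0))"
    unfolding computable_on_def by blast
  from this[of "[_, _]"] have h: "evals X h [u, c] (LEAST t. t = u \<or> W X c t u)" for X u c
    by simp
  define M where "M = Comp h [q, Proj 0]"
  have "prefix_free {\<sigma>. \<exists>y. evals X M [str_code \<sigma>] y}" for X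
  proof (rule prefix_free_unary_header[of "{[]}"])
    show "{\<sigma>. \<exists>y. evals X M [str_code \<sigma>] y} \<subseteq> (\<Union>j. (\<lambda>\<pi>. replicate j True @ False # \<pi>) ` {[]})"
    proof
      fix \<sigma>
      assume "\<sigma> \<in> {\<sigma>. \<exists>y. evals X M [str_code \<sigma>] y}"
      then obtain u where "evals X q [str_code \<sigma>] u"
        unfolding M_def by (auto elim!: evals_CompE simp: list_all2_Cons1)
      then obtain i where "str_code \<sigma> + 2 = 2 ^ i * 3"
        by (auto simp: q W_def)
      then show "\<sigma> \<in> (\<Union>j. (\<lambda>\<pi>. replicate j True @ False # \<pi>) ` {[]})"
        using str_code_unary_headerD[of \<sigma> i "[]"] by simp
    qed
  qed (simp add: prefix_free_def)
  then obtain \<rho> where \<rho>: "\<And>X \<sigma> \<tau>. evals X M [str_code \<sigma>] (str_code \<tau>) \<Longrightarrow> U X (\<rho> @ \<sigma>) = Some \<tau>"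
    using universal_machine_simulates[OF U] by blast
  have "KO U A \<sigma> \<le> i + (length \<rho> + 1)"
    if ex: "\<exists>m. A (prod_encode (prod_encode (i, str_code \<sigma>), m))"
      and uniq: "\<And>t m. A (prod_encode (prod_encode (i, t), m)) \<Longrightarrow> t = str_code \<sigma>" for A i \<sigma>
  proof -
    define c where "c = str_code (replicate i True @ [False])"
    have c: "c + 2 = 2 ^ i * 3"
      unfolding c_def using str_code_unary_header[of i "[]"] by simp
    have i: "i \<le> c"
      using unary_index_le[of c i 0] c by simp
    have W: "W A c t u \<longleftrightarrow> (\<exists>m\<le>u. A (prod_encode (prod_encode (i, t), m)))" for t u
      unfolding W_def using c i by auto
    obtain m where m: "A (prod_encode (prod_encode (i, str_code \<sigma>), m))"
      using ex by blast
    have "\<exists>u. \<exists>t\<le>u. W A c t u"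
      unfolding W using m
      by (intro exI[of _ "max m (str_code \<sigma>)"] exI[of _ "str_code \<sigma>"] conjI exI[of _ m]) auto
    then have ex_u: "\<exists>t\<le>(LEAST u. \<exists>t\<le>u. W A c t u). W A c t (LEAST u. \<exists>t\<le>u. W A c t u)"
      by (rule LeastI_ex)
    define u where "u = (LEAST u. \<exists>t\<le>u. W A c t u)"
    have u: "evals A q [c] u"
      using ex_u not_less_Least unfolding u_def by (auto simp: q)
    obtain t where "t \<le> u" "W A c t u"
      using ex_u unfolding u_def by blast
    \<comment> \<open>The true value is at most \<open>u\<close>, so the default
      \<open>t = u\<close> cannot undercut it.\<close>
    then have "str_code \<sigma> \<le> u" "W A c (str_code \<sigma>) u"
      using uniq unfolding W by auto
    then have "(LEAST t. t = u \<or> W A c t u) = str_code \<sigma>"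
      using uniq by (intro Least_equality) (auto simp: W)
    then have "evals A M [c] (str_code \<sigma>)"
      unfolding M_def using u h[of A u c] evals.proj[of 0 "[c]" A]
      by (intro evals.comp[where ys = "[u, c]"]) auto
    then have "U A (\<rho> @ replicate i True @ [False]) = Some \<sigma>"
      unfolding c_def by (rule \<rho>)
    from KO_le[of U A, OF this] show ?thesis by simp
  qed
  then show thesis using that by blast
qed

section \<open>Countability of the \<open>\<Delta>\<^sup>0\<^sub>2\<close> functions\<close>

instance prog :: countable
  by countable_datatype

text \<open>A function is determined by any program deciding the matrix of an exists-forall
  definition of its graph, and there are countably many programs.\<close>

lemma countable_Delta02: "countable {g. Delta02_fun g}"
proof -
  have "\<exists>p. \<forall>x y. g x = y \<longleftrightarrow> (\<exists>a. \<forall>b. evals (\<lambda>_. False) p [a, b, x, y] 1)" if g: "Delta02_fun g" for g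
  proof -
    obtain S where S: "computable_rel (2 + 2) S"
      "\<forall>xs. length xs = 2 \<longrightarrow> (g (xs ! 0) = xs ! 1 \<longleftrightarrow> (\<exists>a. \<forall>b. S (a # b # xs)))"
      using g unfolding Delta02_fun_def Delta02_def Sigma02_def by blast
    obtain p where p: "\<And>xs. length xs = 4 \<Longrightarrow> evals (\<lambda>_. False) p xs (of_bool (S xs))"
      using S(1) unfolding computable_rel_def by auto
    have "S [a, b, x, y] \<longleftrightarrow> evals (\<lambda>_. False) p [a, b, x, y] 1" for a b x y
      using p[of "[a, b, x, y]"] evals_deterministic by (cases "S [a, b, x, y]") fastforce+
    moreover have "g x = y \<longleftrightarrow> (\<exists>a. \<forall>b. S [a, b, x, y])" for x y
      using S(2)[rule_format, of "[x, y]"] by simp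
    ultimately show ?thesis by auto
  qed
  then obtain p where p: "\<And>g x y. Delta02_fun g \<Longrightarrow>
      g x = y \<longleftrightarrow> (\<exists>a. \<forall>b. evals (\<lambda>_. False) (p g) [a, b, x, y] 1)"
    by metis
  have "inj_on p {g. Delta02_fun g}"
  proof (rule inj_onI, rule ext)
    fix g h x
    assume "g \<in> {g. Delta02_fun g}" "h \<in> {g. Delta02_fun g}" "p g = p h"
    then show "g x = h x"
      using p[of g x "h x"] p[of h x "h x"] by simp
  qed
  then show ?thesis
    using countableI'[of "to_nat \<circ> p"] by (simp add: comp_inj_on inj_on_subset[OF inj_to_nat])
qed

section \<open>Assembling the real\<close>

lemma initial_segment_cong:
  "(\<And>x. x < n \<Longrightarrow> A x \<longleftrightarrow> B x) \<Longrightarrow> initial_segment A n = initial_segment B n"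
  unfolding initial_segment_def by simp

text \<open>Step \<open>i\<close> serves only the orders of index at most \<open>i\<close>, which
  are finitely many. Each order is thus served from some step on, and the constant absorbs the
  lengths before it.\<close>

lemma KT_real_describing:
  fixes s :: "nat \<Rightarrow> bool list"
  assumes U: "universal_machine U"
  obtains A c where "A \<in> KT_Delta02 U" "\<And>i. KO U A (s i) \<le> i + c"
proof -
  define \<G> where "\<G> = {g. order_fun g \<and> Delta02_fun g}"
  have "countable \<G>"
    unfolding \<G>_def by (rule countable_subset[OF _ countable_Delta02]) auto
  define G where "G i = \<G> \<inter> {g. to_nat_on \<G> g \<le> i}" for i
  have fin: "finite (G i)" for i
  proof (rule inj_on_finite[where f = "to_nat_on \<G>"])
    show "inj_on (to_nat_on \<G>) (G i)"
      using inj_on_to_nat_on[OF \<open>countable \<G>\<close>] by (rule inj_on_subset) (simp add: G_def)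
    show "to_nat_on \<G> ` G i \<subseteq> {..i}"
      by (auto simp: G_def)
  qed simp
  define next_set where "next_set i E E' m \<longleftrightarrow>
    (let p = prod_encode (prod_encode (i, str_code (s i)), m) in
      E' = insert p E \<and> (\<forall>q\<in>E. q < p) \<and>
      (\<forall>n>p. \<forall>g\<in>G i. K U (initial_segment (\<lambda>x. x \<in> insert p E) n) \<le> K_nat U n + g p))" for i E E' m
  \<comment> \<open>The clause for \<open>i = 0\<close> makes dependent choice start from the empty
    set.\<close>
  have "\<exists>E. \<forall>i. (finite (E i) \<and> (i = 0 \<longrightarrow> E i = {})) \<and> (\<exists>m. next_set i (E i) (E (Suc i)) m)"
  proof (rule dependent_nat_choice)
    fix E :: "nat set" and i :: nat
    assume *: "finite E \<and> (i = 0 \<longrightarrow> E = {})"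
    have "\<forall>g\<in>G i. order_fun g \<and> Delta02_fun g"
      by (simp add: G_def \<G>_def)
    note step = coding_step[OF U conjunct1[OF *] fin this, of "prod_encode (i, str_code (s i))"]
    obtain m where "next_set i E (insert (prod_encode (prod_encode (i, str_code (s i)), m)) E) m"
    proof (rule step)
      fix m
      let ?p = "prod_encode (prod_encode (i, str_code (s i)), m)"
      assume "\<forall>q\<in>E. q < ?p" and "\<forall>n>?p. \<forall>g\<in>G i.
        K U (initial_segment (\<lambda>x. x \<in> insert ?p E) n) \<le> K_nat U n + g ?p"
      then have "next_set i E (insert ?p E) m"
        unfolding next_set_def Let_def by (intro conjI refl)
      then show thesis by (rule that)
    qed
    then show "\<exists>E'. (finite E' \<and> (Suc i = 0 \<longrightarrow> E' = {})) \<and> (\<exists>m. next_set i E E' m)"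
      using * by (intro exI[of _ "insert _ E"]) auto
  qed auto
  then obtain E m where E0: "E 0 = {}" and E: "\<And>i. next_set i (E i) (E (Suc i)) (m i)"
    by metis
  define p where "p i = prod_encode (prod_encode (i, str_code (s i)), m i)" for i
  have Suc: "E (Suc i) = insert (p i) (E i)" and less: "q \<in> E i \<Longrightarrow> q < p i"
    and K: "p i < n \<Longrightarrow> g \<in> G i \<Longrightarrow> K U (initial_segment (\<lambda>x. x \<in> E (Suc i)) n) \<le> K_nat U n + g (p i)"
    for i n g q
    using E[of i] unfolding next_set_def Let_def p_def by auto
  have E_eq: "E i = p ` {..<i}" for i
    by (induction i) (auto simp: E0 Suc lessThan_Suc)
  have mono: "strict_mono p"
    using less by (intro strict_monoI) (auto simp: E_eq)
  define A where "A x \<longleftrightarrow> x \<in> range p" for x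
  have "A \<in> KT U g" if g: "g \<in> \<G>" for g
  proof -
    define k where "k = to_nat_on \<G> g"
    \<comment> \<open>From step \<open>k\<close> on, \<open>g\<close> is among the orders served;
      the lengths up to \<open>p k\<close> are paid for by \<open>c\<close>.\<close>
    define c where "c = (\<Sum>n\<le>p k. K U (initial_segment A n))"
    have "K U (initial_segment A n) \<le> K_nat U n + g n + c" for n
    proof (cases "n \<le> p k")
      case True
      then have "K U (initial_segment A n) \<le> c"
        unfolding c_def by (intro member_le_sum) auto
      then show ?thesis by simp
    next
      case False
      have ex: "\<exists>l. n \<le> p l"
        using strict_mono_imp_increasing[OF mono] by blast
      \<comment> \<open>This locates \<open>n\<close> between consecutive elements:
        \<open>l = Suc i\<close> and \<open>p i < n \<le> p (Suc i)\<close>.\<close>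
      define l where "l = (LEAST l. n \<le> p l)"
      have l: "n \<le> p l"
        unfolding l_def using ex by (rule LeastI_ex)
      have "k < l"
        using False l mono by (metis leI order_trans strict_mono_less_eq)
      then obtain i where i: "l = Suc i" "k \<le> i"
        by (metis less_Suc_eq_le less_imp_Suc_add)
      have n: "p i < n"
        using not_less_Least[of i "\<lambda>l. n \<le> p l"] i unfolding l_def by simp
      \<comment> \<open>Later elements of \<open>A\<close> are at least \<open>p (Suc i)\<close>,
        hence not below \<open>n\<close>.\<close>
      have "initial_segment A n = initial_segment (\<lambda>x. x \<in> E (Suc i)) n"
      proof (rule initial_segment_cong)
        fix x
        assume "x < n"
        have "a < Suc i" if "p a < n" for a
          using that l i(1) mono by (metis less_le_trans strict_mono_less)
        with \<open>x < n\<close> show "A x \<longleftrightarrow> x \<in> E (Suc i)"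
          unfolding A_def E_eq by blast
      qed
      then have "K U (initial_segment A n) \<le> K_nat U n + g (p i)"
        using K[OF n, of g] g i(2) by (simp add: G_def k_def)
      moreover have "g (p i) \<le> g n"
        using g n by (auto simp: \<G>_def order_fun_def intro!: monoD[of g])
      ultimately show ?thesis by simp
    qed
    then show ?thesis unfolding KT_def by blast
  qed
  then have A: "A \<in> KT_Delta02 U"
    unfolding KT_Delta02_def \<G>_def by blast
  obtain c where c: "\<And>A i \<sigma>. \<exists>m. A (prod_encode (prod_encode (i, str_code \<sigma>), m)) \<Longrightarrow>
    (\<And>t m. A (prod_encode (prod_encode (i, t), m)) \<Longrightarrow> t = str_code \<sigma>) \<Longrightarrow> KO U A \<sigma> \<le> i + c"
    using decoding[OF U] by blast
  have "KO U A (s i) \<le> i + c" for i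
  proof (rule c)
    show "\<exists>m. A (prod_encode (prod_encode (i, str_code (s i)), m))"
      unfolding A_def p_def by blast
    \<comment> \<open>Pairing is injective, so only \<open>p i\<close> carries the index
      \<open>i\<close>.\<close>
    show "t = str_code (s i)" if "A (prod_encode (prod_encode (i, t), m))" for t m
      using that unfolding A_def p_def by auto
  qed
  with A that show thesis by blast
qed

theorem corollary2p6:
  fixes U :: oracle_machine and f :: "bool list \<Rightarrow> nat"
  assumes "universal_machine U"
  shows "LK U f = UNIV \<or> \<not> KT_Delta02 U \<subseteq> LK U f"
proof (rule ccontr)
  assume "\<not> ?thesis"
  then obtain X where X: "X \<notin> LK U f" and sub: "KT_Delta02 U \<subseteq> LK U f" by blast
  \<comment> \<open>\<open>X\<close> defeats every constant, in particular \<open>2 * c\<close>; its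
    own term \<open>KO U X \<sigma>\<close> is then dropped.\<close>
  have "\<exists>\<sigma>. f \<sigma> + 2 * c < K U \<sigma>" for c
  proof -
    obtain \<sigma> where "KO U X \<sigma> + f \<sigma> + 2 * c < K U \<sigma>"
      using X unfolding LK_def by (auto simp: not_le)
    then have "f \<sigma> + 2 * c < K U \<sigma>" by simp
    then show ?thesis ..
  qed
  then obtain s where s: "\<And>i. f (s i) + 2 * i < K U (s i)" by metis
  obtain A c where "A \<in> KT_Delta02 U" and c: "\<And>i. KO U A (s i) \<le> i + c"
    using KT_real_describing[OF assms] by blast
  then obtain d where d: "\<And>\<sigma>. K U \<sigma> \<le> KO U A \<sigma> + f \<sigma> + d"
    using sub unfolding LK_def by blast
  \<comment> \<open>At \<open>i = c + d\<close> the upper bound \<open>(i + c) + f (s i) + d\<close>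
    equals \<open>f (s i) + 2 * i\<close>, against the choice of \<open>s i\<close>.\<close>
  show False
    using s[of "c + d"] c[of "c + d"] d[of "s (c + d)"] by simp
qed

end
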